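(* If $n$ is a positive integer, then $\chi_{2}^{f}(\mathbb{Z}^{\boxtimes,n})=\frac{3^{n}+1}{2}$.
   Context: $\mathbb{Z}$ denotes the two-way infinite path (vertices are the integers, with $i$ and $j$ adjacent iff $|i-j|=1$), and $\mathbb{Z}^{\boxtimes,n}$ is the strong product $\mathbb{Z}\boxtimes\cdots\boxtimes\mathbb{Z}$ with $n$ factors: the infinite graph on $\mathbb{Z}^n$ in which two distinct vertices $x,y$ are adjacent iff $|x_i-y_i|\le 1$ for all $i$. A $2$-frugal coloring of a graph is a proper vertex coloring in which no color appears more than twice in the (open) neighborhood of any vertex; $\chi_2^f$ is the minimum number of colors in a $2$-frugal coloring. *)

theory Defs
  imports "HOL-Library.FuncSet" "HOL-Library.Extended_Nat"
begin

record 'a ugraph =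
  verts :: "'a set"
  adj :: "'a \<Rightarrow> 'a \<Rightarrow> bool"

definition simple_graph :: "'a ugraph \<Rightarrow> bool" where
  "simple_graph G \<longleftrightarrow>
    (\<forall>x y. adj G x y \<longrightarrow> x \<in> verts G \<and> y \<in> verts G \<and> x \<noteq> y \<and> adj G y x)"

definition neighborhood :: "'a ugraph \<Rightarrow> 'a \<Rightarrow> 'a set" where
  "neighborhood G v = {u \<in> verts G. adj G v u}"

definition proper_coloring :: "'a ugraph \<Rightarrow> ('a \<Rightarrow> 'c) \<Rightarrow> bool" where
  "proper_coloring G c \<longleftrightarrow> (\<forall>u\<in>verts G. \<forall>v\<in>verts G. adj G u v \<longrightarrow> c u \<noteq> c v)"

(* Finiteness is required explicitly because card of an infinite set is 0. *)
definition frugal_coloring :: "nat \<Rightarrow> 'a ugraph \<Rightarrow> ('a \<Rightarrow> 'c) \<Rightarrow> bool" where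
  "frugal_coloring t G c \<longleftrightarrow> proper_coloring G c \<and>
    (\<forall>v\<in>verts G. \<forall>a. finite {u \<in> neighborhood G v. c u = a} \<and>
                      card {u \<in> neighborhood G v. c u = a} \<le> t)"

(* The value is \<infinity> if no finite number of colors suffices (Inf {} = \<infinity> in enat). *)
definition frugal_chromatic_number :: "nat \<Rightarrow> 'a ugraph \<Rightarrow> enat" where
  "frugal_chromatic_number t G =
    Inf {enat k | k. \<exists>c :: 'a \<Rightarrow> nat. c ` verts G \<subseteq> {..<k} \<and> frugal_coloring t G c}"

definition int_path :: "int ugraph" where
  "int_path = \<lparr>verts = UNIV, adj = (\<lambda>i j. \<bar>i - j\<bar> = 1)\<rparr>"

(* Vertices are the extensional functions on I, so that each tuple is represented once. *)
definition strong_product :: "'i set \<Rightarrow> ('i \<Rightarrow> 'a ugraph) \<Rightarrow> ('i \<Rightarrow> 'a) ugraph" where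
  "strong_product I G =
    \<lparr>verts = (\<Pi>\<^sub>E i\<in>I. verts (G i)),
     adj = (\<lambda>x y. x \<in> (\<Pi>\<^sub>E i\<in>I. verts (G i)) \<and> y \<in> (\<Pi>\<^sub>E i\<in>I. verts (G i)) \<and> x \<noteq> y \<and>
                  (\<forall>i\<in>I. x i = y i \<or> adj (G i) (x i) (y i)))\<rparr>"

definition strong_power :: "'a ugraph \<Rightarrow> nat \<Rightarrow> (nat \<Rightarrow> 'a) ugraph" where
  "strong_power G n = strong_product {..<n} (\<lambda>_. G)"

lemma simple_graph_int_path: "simple_graph int_path"
  by (auto simp: simple_graph_def int_path_def)

lemma simple_graph_strong_product:
  assumes "\<And>i. i \<in> I \<Longrightarrow> simple_graph (G i)"
  shows "simple_graph (strong_product I G)"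
  using assms unfolding simple_graph_def strong_product_def by fastforce

lemma verts_strong_power_int_path:
  "verts (strong_power int_path n) = {..<n} \<rightarrow>\<^sub>E UNIV"
  by (simp add: strong_power_def strong_product_def int_path_def)

lemma adj_strong_power_int_path:
  assumes "x \<in> {..<n} \<rightarrow>\<^sub>E UNIV" "y \<in> {..<n} \<rightarrow>\<^sub>E UNIV"
  shows "adj (strong_power int_path n) x y \<longleftrightarrow> x \<noteq> y \<and> (\<forall>i<n. \<bar>x i - y i\<bar> \<le> 1)"
proof -
  have "(a = b \<or> \<bar>a - b\<bar> = 1) \<longleftrightarrow> \<bar>a - b\<bar> \<le> 1" for a b :: int
    by linarith
  with assms show ?thesis
    by (simp add: strong_power_def strong_product_def int_path_def Ball_def)
qed

lemma two_dvd_three_power_plus_one: "2 dvd (3 ^ n + 1 :: nat)"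
  by simp

end

theory Submission
  imports Defs
begin

text \<open>
  Both bounds come from the closed neighborhood of a vertex, a cube with \<open>3\<^sup>n\<close> points.

  Lower bound: all \<open>3\<^sup>n - 1\<close> neighbors of a vertex avoid its color, and each of the
  other \<open>k - 1\<close> colors occurs at most twice among them, so \<open>3\<^sup>n - 1 \<le> 2 (k - 1)\<close>
  (\<open>card_neighborhood_le_of_frugal_coloring\<close>).

  Upper bound: put \<open>m = (3\<^sup>n + 1) / 2\<close> and color \<open>x\<close> with \<open>(\<Sum>i<n. 3\<^sup>i x\<^sub>i) mod m\<close>.
  The offsets from a vertex to the points of its closed neighborhood are the digit
  vectors with entries in \<open>{-1, 0, 1}\<close>, and by uniqueness of balanced ternary notation
  (\<open>ternary_value_eq_0_imp\<close>) their weighted sums are the \<open>3\<^sup>n\<close> distinct integers in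
  \<open>[-(m - 1), m - 1]\<close>. In this interval the only multiple of \<open>m\<close> is \<open>0\<close>, which belongs
  to the vertex itself, so the coloring is proper; every other residue class meets it in
  just two integers, \<open>r\<close> and \<open>r - m\<close>, so the coloring is 2-frugal.
\<close>

section \<open>Lower bound by counting neighbors\<close>

lemma card_neighborhood_le_of_frugal_coloring:
  fixes c :: "'a \<Rightarrow> nat"
  assumes frugal: "frugal_coloring t G c"
    and colors: "c ` verts G \<subseteq> {..<k}"
    and v: "v \<in> verts G"
  shows "card (neighborhood G v) \<le> t * (k - 1)"
proof -
  let ?N = "neighborhood G v"
  let ?C = "{..<k} - {c v}"
  have "c u \<in> ?C" if "u \<in> ?N" for u
  proof -
    have u: "u \<in> verts G" "adj G v u"
      using that by (simp_all add: neighborhood_def)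
    then have "c v \<noteq> c u"
      using frugal v by (simp add: frugal_coloring_def proper_coloring_def)
    then show ?thesis
      using colors u by auto
  qed
  then have "?N = (\<Union>a\<in>?C. {u \<in> ?N. c u = a})"
    by blast
  also have "card \<dots> \<le> (\<Sum>a\<in>?C. card {u \<in> ?N. c u = a})"
    by (rule card_UN_le) simp
  also have "\<dots> \<le> (\<Sum>a\<in>?C. t)"
    using frugal v by (intro sum_mono) (simp add: frugal_coloring_def)
  also have "\<dots> = t * (k - 1)"
  proof -
    have "c v \<in> {..<k}"
      using colors v by blast
    then show ?thesis
      by (simp add: mult.commute)
  qed
  finally show ?thesis .
qed

lemma card_neighborhood_strong_power_int_path:
  assumes "v \<in> verts (strong_power int_path n)"
  shows "card (neighborhood (strong_power int_path n) v) = 3 ^ n - 1"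
proof -
  let ?cube = "\<Pi>\<^sub>E i\<in>{..<n}. {v i - 1..v i + 1}"
  have v: "v \<in> {..<n} \<rightarrow>\<^sub>E UNIV"
    using assms by (simp add: verts_strong_power_int_path)
  have "neighborhood (strong_power int_path n) v = ?cube - {v}"
  proof (rule set_eqI)
    fix u
    have near: "\<bar>v i - u i\<bar> \<le> 1 \<longleftrightarrow> v i - 1 \<le> u i \<and> u i \<le> v i + 1" for i
      by auto
    have "u \<in> neighborhood (strong_power int_path n) v \<longleftrightarrow>
        u \<in> {..<n} \<rightarrow>\<^sub>E UNIV \<and> v \<noteq> u \<and> (\<forall>i<n. \<bar>v i - u i\<bar> \<le> 1)"
      unfolding neighborhood_def verts_strong_power_int_path
      using adj_strong_power_int_path[OF v] by blast
    then show "u \<in> neighborhood (strong_power int_path n) v \<longleftrightarrow> u \<in> ?cube - {v}"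
      by (auto simp: near PiE_iff simp del: diff_le_eq)
  qed
  moreover have "v \<in> ?cube"
    using v by (auto simp: PiE_iff)
  moreover have "card ?cube = 3 ^ n"
    by (simp add: card_PiE)
  ultimately show ?thesis
    by simp
qed

section \<open>Balanced ternary notation\<close>

definition ternary_value :: "nat \<Rightarrow> (nat \<Rightarrow> int) \<Rightarrow> int" where
  "ternary_value n d = (\<Sum>i<n. 3 ^ i * d i)"

lemma ternary_value_diff:
  "ternary_value n (\<lambda>i. x i - y i) = ternary_value n x - ternary_value n y"
  by (simp add: ternary_value_def right_diff_distrib sum_subtractf)

text \<open>
  Attained when all digits are \<open>b\<close>. The case \<open>b = 1\<close> locates the colors near a vertex,
  and \<open>b = 2\<close> serves for comparing two digit vectors with entries in \<open>{-1, 0, 1}\<close>.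
\<close>
lemma ternary_value_bound:
  assumes "\<And>i. i < n \<Longrightarrow> \<bar>d i\<bar> \<le> b"
  shows "2 * \<bar>ternary_value n d\<bar> \<le> b * (3 ^ n - 1)"
  using assms
proof (induction n)
  case 0
  then show ?case
    by (simp add: ternary_value_def)
next
  case (Suc n)
  have "\<bar>3 ^ n * d n\<bar> \<le> 3 ^ n * b"
    using Suc.prems[of n] by (simp add: abs_mult)
  moreover have "2 * \<bar>ternary_value n d\<bar> \<le> b * (3 ^ n - 1)"
    using Suc by simp
  moreover have "\<bar>ternary_value (Suc n) d\<bar> \<le> \<bar>ternary_value n d\<bar> + \<bar>3 ^ n * d n\<bar>"
    by (simp add: ternary_value_def)
  moreover have "b * (3 ^ Suc n - 1) = b * (3 ^ n - 1) + 2 * (3 ^ n * b)"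
    by (simp add: algebra_simps)
  ultimately show ?case
    by linarith
qed

text \<open>
  Uniqueness of balanced ternary notation, stated for the difference of two
  representations: digits in \<open>{-1, 0, 1}\<close> differ by at most 2. The lower digits together
  contribute less than \<open>3\<^sup>n\<close> and so cannot cancel a nonzero leading digit.
\<close>
lemma ternary_value_eq_0_imp:
  assumes "\<And>i. i < n \<Longrightarrow> \<bar>d i\<bar> \<le> 2"
    and "ternary_value n d = 0"
    and "i < n"
  shows "d i = 0"
  using assms
proof (induction n)
  case 0
  then show ?case
    by simp
next
  case (Suc n)
  have split: "ternary_value n d + 3 ^ n * d n = 0"
    using Suc.prems(2) by (simp add: ternary_value_def)
  have "2 * \<bar>ternary_value n d\<bar> \<le> 2 * (3 ^ n - 1)"
    using Suc.prems(1) by (intro ternary_value_bound) simp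
  moreover have "\<bar>3 ^ n * d n\<bar> = \<bar>ternary_value n d\<bar>"
    using split by (simp add: add_eq_0_iff)
  ultimately have small: "\<bar>3 ^ n * d n\<bar> < 3 ^ n"
    by simp
  have "d n = 0"
  proof (rule ccontr)
    assume "d n \<noteq> 0"
    then have "3 ^ n * 1 \<le> 3 ^ n * \<bar>d n\<bar>"
      by (intro mult_left_mono) auto
    then show False
      using small by (simp add: abs_mult)
  qed
  with Suc split show ?case
    by (cases "i = n") auto
qed

lemma ternary_value_eq_imp_eq:
  assumes "x \<in> {..<n} \<rightarrow>\<^sub>E UNIV" "y \<in> {..<n} \<rightarrow>\<^sub>E UNIV"
    and "\<And>i. i < n \<Longrightarrow> \<bar>x i - y i\<bar> \<le> 2"
    and "ternary_value n x = ternary_value n y"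
  shows "x = y"
proof (rule PiE_ext[OF assms(1,2)])
  fix i assume "i \<in> {..<n}"
  then show "x i = y i"
    using ternary_value_eq_0_imp[of n "\<lambda>i. x i - y i" i] assms
    by (simp add: ternary_value_diff)
qed

section \<open>The coloring by ternary value\<close>

text \<open>
  An interval with \<open>2 m - 1\<close> integers centered at \<open>w\<close> meets a residue class modulo \<open>m\<close>
  at most twice, since each of the half-open intervals \<open>[w, w + m)\<close> and \<open>[w - m, w)\<close>
  contains a single element of the class.
\<close>
lemma residue_class_near_subset:
  fixes m w a :: int
  shows "{z. \<bar>z - w\<bar> < m \<and> z mod m = a} \<subseteq> {w + (a - w) mod m, w + (a - w) mod m - m}"
proof
  fix z assume "z \<in> {z. \<bar>z - w\<bar> < m \<and> z mod m = a}"
  then have near: "\<bar>z - w\<bar> < m" and a: "a = z mod m"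
    by auto
  have r: "(a - w) mod m = (z - w) mod m"
    by (simp add: a mod_diff_left_eq)
  show "z \<in> {w + (a - w) mod m, w + (a - w) mod m - m}"
  proof (cases "z - w \<ge> 0")
    case True
    then have "(z - w) mod m = z - w"
      using near by simp
    then show ?thesis
      using r by simp
  next
    case False
    then have "(z - w + m) mod m = z - w + m"
      using near by (intro mod_pos_pos_trivial) auto
    then show ?thesis
      using r by simp
  qed
qed

definition ternary_coloring :: "nat \<Rightarrow> (nat \<Rightarrow> int) \<Rightarrow> nat" where
  "ternary_coloring n x = nat (ternary_value n x mod int ((3 ^ n + 1) div 2))"

lemma ternary_coloring_less: "ternary_coloring n x < (3 ^ n + 1) div 2"
proof -
  have "(0::nat) < (3 ^ n + 1) div 2"
    by simp
  then show ?thesis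
    unfolding ternary_coloring_def
    by (simp only: nat_less_iff pos_mod_bound pos_mod_sign of_nat_0_less_iff)
qed

lemma frugal_ternary_coloring:
  "frugal_coloring 2 (strong_power int_path n) (ternary_coloring n)"
proof -
  let ?G = "strong_power int_path n"
  let ?W = "ternary_value n"
  let ?V = "{..<n} \<rightarrow>\<^sub>E (UNIV :: int set)"
  define m where "m = int ((3 ^ n + 1) div 2)"
  have "2 * ((3 ^ n + 1) div 2) = (3 ^ n + 1 :: nat)"
    by simp
  then have m: "2 * m = 3 ^ n + 1"
    unfolding m_def by (metis of_nat_1 of_nat_add of_nat_mult of_nat_numeral of_nat_power)
  then have m_pos: "m > 0"
    by (smt (verit) zero_less_power)
  have color_iff: "ternary_coloring n x = a \<longleftrightarrow> ?W x mod m = int a" for x a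
    unfolding ternary_coloring_def m_def[symmetric]
    using m_pos by (metis nat_int int_nat_eq pos_mod_sign)
  have near: "\<bar>?W u - ?W v\<bar> < m" if "\<And>i. i < n \<Longrightarrow> \<bar>u i - v i\<bar> \<le> 1" for u v
    using ternary_value_bound[of n "\<lambda>i. u i - v i" 1] that m
    by (simp add: ternary_value_diff)
  have "proper_coloring ?G (ternary_coloring n)"
    unfolding proper_coloring_def
  proof (intro ballI impI notI)
    fix u v
    assume uv: "u \<in> verts ?G" "v \<in> verts ?G" and adj: "adj ?G u v"
      and same: "ternary_coloring n u = ternary_coloring n v"
    have uv_V: "u \<in> ?V" "v \<in> ?V"
      using uv by (simp_all add: verts_strong_power_int_path)
    have step: "\<bar>u i - v i\<bar> \<le> 1" if "i < n" for i
      using adj that uv_V by (simp add: adj_strong_power_int_path)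
    have "u \<noteq> v"
      using adj uv_V by (simp add: adj_strong_power_int_path)
    have "m dvd ?W u - ?W v"
      using same m_pos color_iff by (metis mod_eq_dvd_iff)
    moreover have "\<bar>?W u - ?W v\<bar> < m"
      using step by (rule near)
    ultimately have "?W u = ?W v"
      using dvd_imp_le_int[of "?W u - ?W v" m] m_pos by auto
    moreover have "\<bar>u i - v i\<bar> \<le> 2" if "i < n" for i
      using step[OF that] by simp
    ultimately have "u = v"
      by (intro ternary_value_eq_imp_eq[OF uv_V])
    with \<open>u \<noteq> v\<close> show False ..
  qed
  moreover have "finite {u \<in> neighborhood ?G v. ternary_coloring n u = a} \<and>
      card {u \<in> neighborhood ?G v. ternary_coloring n u = a} \<le> 2"
    (is "finite ?S \<and> _") if "v \<in> verts ?G" for v a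
  proof -
    have v: "v \<in> ?V"
      using that by (simp add: verts_strong_power_int_path)
    have S: "u \<in> ?V" "?W u mod m = int a" "\<And>i. i < n \<Longrightarrow> \<bar>u i - v i\<bar> \<le> 1"
      if "u \<in> ?S" for u
    proof -
      show u: "u \<in> ?V" and "?W u mod m = int a"
        using that color_iff by (simp_all add: neighborhood_def verts_strong_power_int_path)
      have "adj ?G v u"
        using that by (simp add: neighborhood_def)
      then show "\<bar>u i - v i\<bar> \<le> 1" if "i < n" for i
        using that adj_strong_power_int_path[OF v u] abs_minus_commute[of "u i" "v i"] by simp
    qed
    \<comment> \<open>Two neighbors of \<open>v\<close> may differ by 2 in a coordinate, so their weighted sums are
      compared directly and not through adjacency.\<close>
    have inj: "inj_on ?W ?S"
    proof (rule inj_onI)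
      fix x y assume x: "x \<in> ?S" and y: "y \<in> ?S" and eq: "?W x = ?W y"
      have "\<bar>x i - y i\<bar> \<le> 2" if "i < n" for i
        using S(3)[OF x that] S(3)[OF y that] by linarith
      then show "x = y"
        using eq by (rule ternary_value_eq_imp_eq[OF S(1)[OF x] S(1)[OF y]])
    qed
    let ?R = "{?W v + (int a - ?W v) mod m, ?W v + (int a - ?W v) mod m - m}"
    have "?W ` ?S \<subseteq> {z. \<bar>z - ?W v\<bar> < m \<and> z mod m = int a}"
    proof (rule image_subsetI)
      fix u assume u: "u \<in> ?S"
      have "\<bar>?W u - ?W v\<bar> < m"
        using S(3)[OF u] by (rule near)
      then show "?W u \<in> {z. \<bar>z - ?W v\<bar> < m \<and> z mod m = int a}"
        using S(2)[OF u] by simp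
    qed
    then have image: "?W ` ?S \<subseteq> ?R"
      using residue_class_near_subset by (rule subset_trans)
    have "finite ?S"
      using image by (rule inj_on_finite[OF inj]) simp
    moreover have "card ?S \<le> card ?R"
      using inj image by (intro card_inj_on_le) auto
    moreover have "card ?R \<le> 2"
      by (simp add: card_insert_if)
    ultimately show ?thesis
      by linarith
  qed
  ultimately show ?thesis
    by (auto simp: frugal_coloring_def)
qed

section \<open>The 2-frugal chromatic number\<close>

theorem theorem6p10:
  fixes n :: nat
  assumes "n > 0"
  shows "frugal_chromatic_number 2 (strong_power int_path n) = enat ((3 ^ n + 1) div 2)"
proof -
  let ?G = "strong_power int_path n"
  show ?thesis
    unfolding frugal_chromatic_number_def
  proof (rule antisym)
    have "ternary_coloring n ` verts ?G \<subseteq> {..<(3 ^ n + 1) div 2}"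
      using ternary_coloring_less by blast
    then show "Inf {enat k |k. \<exists>c. c ` verts ?G \<subseteq> {..<k} \<and> frugal_coloring 2 ?G c}
        \<le> enat ((3 ^ n + 1) div 2)"
      using frugal_ternary_coloring by (intro Inf_lower) blast
  next
    show "enat ((3 ^ n + 1) div 2)
        \<le> Inf {enat k |k. \<exists>c. c ` verts ?G \<subseteq> {..<k} \<and> frugal_coloring 2 ?G c}"
    proof (rule Inf_greatest, clarify)
      fix k and c :: "(nat \<Rightarrow> int) \<Rightarrow> nat"
      assume c: "c ` verts ?G \<subseteq> {..<k}" "frugal_coloring 2 ?G c"
      define v :: "nat \<Rightarrow> int" where "v = (\<lambda>i\<in>{..<n}. 0)"
      have v: "v \<in> verts ?G"
        by (simp add: v_def verts_strong_power_int_path)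
      then have "c v < k"
        using c by blast
      moreover have "3 ^ n - 1 \<le> 2 * (k - 1)"
        using card_neighborhood_le_of_frugal_coloring[OF c(2,1) v]
        by (simp add: card_neighborhood_strong_power_int_path[OF v])
      ultimately have "(3 ^ n + 1) div 2 \<le> k"
        by linarith
      then show "enat ((3 ^ n + 1) div 2) \<le> enat k"
        by simp
    qed
  qed
qed

end
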